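(* Let $g$ be a 2-dimensional metric with degree of mobility 3. Assume that $g$ admits exactly one projective vector field $X$ (up to a constant factor), and that $X$ is essential (i.e. non-homothetic for $g$). Let $g$ be given, in local coordinates $(x,y)$, as the metric corresponding to $\sigma=\sigma[\theta,\varphi]$, where $$\sigma=\sin\theta\cos\varphi\,\sigma_1+\sin\theta\sin\varphi\,\sigma_2+\cos\theta\,\sigma_3,$$ $$\bar\sigma=\cos\theta\cos\varphi\,\sigma_1+\cos\theta\sin\varphi\,\sigma_2-\sin\theta\,\sigma_3,$$ $$\hat\sigma=-\sin\varphi\,\sigma_1+\cos\varphi\,\sigma_2,$$ with $\sigma_1,\sigma_2,\sigma_3$ corresponding to the metrics $g_1,g_2,g_3$ of the context. Then $g$, together with the metrics $\bar g,\hat g$ corresponding to $\bar\sigma,\hat\sigma$, gives rise to a free superintegrable system. It is a free second-order maximally superintegrable system in the usual sense: the Hamiltonian $H=\frac12g^{ij}p_ip_j$ and the two quadratic integrals of motion $I,J$ of $H$ associated to $\bar g$ and $\hat g$ are functionally independent.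
   Context: All considerations are local. "Metric" means Riemannian or Lorentzian metric. Two metrics are projectively equivalent if they have the same unparametrized geodesics. A vector field is projective if its local flow preserves unparametrized geodesics; it is homothetic for $g$ if $\mathcal{L}_Xg=c\,g$ for a constant $c$, and essential for $g$ otherwise. To a 2-dimensional metric $g$ corresponds $\sigma^{ij}=|\det g|^{1/3}g^{ij}$, a section of $S^2(M)\otimes(\Lambda^2(M))^{2/3}$; conversely a non-degenerate $\sigma$ determines the metric. Metrics projectively equivalent to $g$ correspond exactly to the non-degenerate solutions of the linear system $$\nabla_a\sigma^{bc}-\tfrac13\left(\delta^c_a\nabla_i\sigma^{ib}+\delta^b_a\nabla_i\sigma^{ic}\right)=0,\qquad \nabla_a\sigma^{bc}=\partial_a\sigma^{bc}+\Gamma^b_{ad}\sigma^{dc}+\Gamma^c_{ad}\sigma^{db}-\tfrac23\Gamma^d_{da}\sigma^{bc},$$ where $\nabla$ (with Christoffel symbols $\Gamma$) is the Levi-Civita connection of $g$. The dimension of its solution space is the degree of mobility of $g$. Nonzero solutions are degenerate only on a nowhere dense set, and one works where the solutions in question are non-degenerate. The metrics $g_i$ are $$g_1=(y^2+x)\,dx\,dy,$$ $$g_2=-2\,\frac{y^2+x}{y^3}\,dx\,dy+\frac{(y^2+x)^2}{y^4}\,dy^2,$$ $$g_3=\frac{y^2+x}{(3x-y^2)^6}\left(9(y^2+x)\,dx^2-4y(9x+y^2)\,dx\,dy+12x(y^2+x)\,dy^2\right).$$ They are projectively equivalent, and $\sigma_1,\sigma_2,\sigma_3$ form a basis of the 3-dimensional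 solution space. They are eigenvectors of $\mathcal{L}_X$ for the projective vector field $X$. The parameters satisfy $\theta\in(0,\pi)$, $\varphi\in[0,2\pi)$, with $\varphi\notin\{0,\frac\pi2,\pi,\frac{3\pi}2\}$ if $\theta=\frac\pi2$ (so that $X$ is essential for $g$). Integrals: if $\check g$ is projectively equivalent to $g$ in dimension 2, then $$K=\left(\frac{\det g}{\det\check g}\right)^{2/3}\check g$$ (absolute value is understood in the fractional power) is a Killing tensor of $g$, and $K^{ij}p_ip_j$ (indices raised with $g$) is an integral of motion, i.e. it Poisson-commutes with $H=\frac12g^{ij}p_ip_j$ on $T^*M$. The integrals $I$ and $J$ are obtained in this way with $\check g=\bar g$ and $\check g=\hat g$, respectively. A Hamiltonian system on an $n$-dimensional manifold is (maximally) superintegrable if it admits $2n-1$ functionally independent integrals of motion, including the Hamiltonian (for $n=2$: three). It is of second order if the integrals are polynomials of degree at most 2 in momenta, and free if the Hamiltonian has no potential term. Functional independence means that the differentials are linearly independent at generic points of $T^*M$. *)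

theory Defs
  imports "HOL-Analysis.Analysis" "HOL-Library.Function_Algebras"
begin

section \<open>Smoothness\<close>

text \<open>Meant for open \<open>S\<close>: all iterated directional derivatives up to order \<open>k\<close> along basis vectors
  exist (as Frechet derivatives) and are continuous.\<close>

primrec Ck_on :: "nat \<Rightarrow> ('a::euclidean_space \<Rightarrow> 'b::real_normed_vector) \<Rightarrow> 'a set \<Rightarrow> bool" where
  "Ck_on 0 f S \<longleftrightarrow> continuous_on S f"
| "Ck_on (Suc k) f S \<longleftrightarrow> (\<forall>x\<in>S. f differentiable at x) \<and>
     (\<forall>b\<in>Basis. Ck_on k (\<lambda>x. frechet_derivative f (at x) b) S)"

definition smooth_on :: "('a::euclidean_space \<Rightarrow> 'b::real_normed_vector) \<Rightarrow> 'a set \<Rightarrow> bool" where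
  "smooth_on f S \<longleftrightarrow> (\<forall>k. Ck_on k f S)"

definition pd :: "'n \<Rightarrow> (real^'n \<Rightarrow> real) \<Rightarrow> real^'n \<Rightarrow> real" where
  "pd i f x = frechet_derivative f (at x) (axis i 1)"


section \<open>Metrics in a coordinate chart\<close>

type_synonym 'n tensor2 = "real^'n \<Rightarrow> real^'n^'n"

text \<open>Nondegenerate symmetric tensors of any signature; in dimension 2 this is a Riemannian or
  Lorentzian metric up to an overall sign, i.e. exactly what a nondegenerate \<open>\<sigma>\<close> determines.\<close>

definition metric_on :: "(real^'n) set \<Rightarrow> 'n tensor2 \<Rightarrow> bool" where
  "metric_on U g \<longleftrightarrow> smooth_on g U \<and> (\<forall>x\<in>U. transpose (g x) = g x \<and> det (g x) \<noteq> 0)"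

definition christoffel :: "'n::finite tensor2 \<Rightarrow> 'n \<Rightarrow> 'n \<Rightarrow> 'n \<Rightarrow> real^'n \<Rightarrow> real" where
  "christoffel g k i j x = (\<Sum>l\<in>UNIV. matrix_inv (g x) $ k $ l *
     (pd i (\<lambda>z. g z $ j $ l) x + pd j (\<lambda>z. g z $ i $ l) x - pd l (\<lambda>z. g z $ i $ j) x)) / 2"

text \<open>The weighted tensor \<open>\<sigma>\<^sup>i\<^sup>j = |det g|\<^sup>1\<^sup>/\<^sup>3 g\<^sup>i\<^sup>j\<close> of a 2-dimensional metric.\<close>

definition sigma_of :: "2 tensor2 \<Rightarrow> 2 tensor2" where
  "sigma_of g x = root 3 \<bar>det (g x)\<bar> *\<^sub>R matrix_inv (g x)"


section \<open>Degree of mobility\<close>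

definition nabla_sigma :: "2 tensor2 \<Rightarrow> 2 tensor2 \<Rightarrow> 2 \<Rightarrow> 2 \<Rightarrow> 2 \<Rightarrow> real^2 \<Rightarrow> real" where
  "nabla_sigma g \<sigma> a b c x = pd a (\<lambda>z. \<sigma> z $ b $ c) x
     + (\<Sum>d\<in>UNIV. christoffel g b a d x * \<sigma> x $ d $ c)
     + (\<Sum>d\<in>UNIV. christoffel g c a d x * \<sigma> x $ d $ b)
     - 2/3 * (\<Sum>d\<in>UNIV. christoffel g d d a x) * \<sigma> x $ b $ c"

definition kronecker :: "'n \<Rightarrow> 'n \<Rightarrow> real" where
  "kronecker i j = (if i = j then 1 else 0)"

text \<open>Sections over \<open>U\<close> are represented by functions that vanish outside \<open>U\<close>, so that the solution
  space is a genuine vector space with pointwise operations.\<close>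

definition solution_space :: "(real^2) set \<Rightarrow> 2 tensor2 \<Rightarrow> 2 tensor2 set" where
  "solution_space U g = {\<sigma>. smooth_on \<sigma> U \<and> (\<forall>x. x \<notin> U \<longrightarrow> \<sigma> x = 0) \<and>
     (\<forall>x\<in>U. transpose (\<sigma> x) = \<sigma> x \<and>
       (\<forall>a b c. nabla_sigma g \<sigma> a b c x
          - 1/3 * (kronecker c a * (\<Sum>i\<in>UNIV. nabla_sigma g \<sigma> i i b x)
                 + kronecker b a * (\<Sum>i\<in>UNIV. nabla_sigma g \<sigma> i i c x)) = 0))}"

definition degree_of_mobility :: "(real^2) set \<Rightarrow> 2 tensor2 \<Rightarrow> nat" where
  "degree_of_mobility U g = vector_space.dim (\<lambda>(r::real) \<sigma> x. r *\<^sub>R \<sigma> x) (solution_space U g)"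


section \<open>Geodesics and projective vector fields\<close>

definition velocity :: "(real \<Rightarrow> real^'n) \<Rightarrow> real \<Rightarrow> real^'n" where
  "velocity \<gamma> t = vector_derivative \<gamma> (at t)"

definition geodesic :: "'n::finite tensor2 \<Rightarrow> real set \<Rightarrow> (real \<Rightarrow> real^'n) \<Rightarrow> bool" where
  "geodesic g T \<gamma> \<longleftrightarrow> smooth_on \<gamma> T \<and> (\<forall>t\<in>T. velocity \<gamma> t \<noteq> 0 \<and>
     (\<forall>k. velocity (velocity \<gamma>) t $ k + (\<Sum>i\<in>UNIV. \<Sum>j\<in>UNIV.
        christoffel g k i j (\<gamma> t) * velocity \<gamma> t $ i * velocity \<gamma> t $ j) = 0))"

definition unparametrized_geodesic ::
  "(real^'n::finite) set \<Rightarrow> 'n tensor2 \<Rightarrow> real set \<Rightarrow> (real \<Rightarrow> real^'n) \<Rightarrow> bool" where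
  "unparametrized_geodesic U g T \<gamma> \<longleftrightarrow> open T \<and> is_interval T \<and> smooth_on \<gamma> T \<and> \<gamma> ` T \<subseteq> U \<and>
     (\<exists>S \<tau>. open S \<and> is_interval S \<and> smooth_on \<tau> S \<and> \<tau> ` S = T \<and>
        (\<forall>s\<in>S. vector_derivative \<tau> (at s) \<noteq> (0::real)) \<and> geodesic g S (\<gamma> \<circ> \<tau>))"

definition local_flow ::
  "(real^'n) set \<Rightarrow> (real^'n \<Rightarrow> real^'n) \<Rightarrow> (real^'n) set \<Rightarrow> real \<Rightarrow> (real \<Rightarrow> real^'n \<Rightarrow> real^'n) \<Rightarrow> bool" where
  "local_flow U X V \<epsilon> \<Phi> \<longleftrightarrow> open V \<and> V \<subseteq> U \<and> \<epsilon> > 0 \<and>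
     (\<forall>x\<in>V. \<Phi> 0 x = x \<and> (\<forall>t\<in>{-\<epsilon><..<\<epsilon>}. \<Phi> t x \<in> U \<and>
        ((\<lambda>s. \<Phi> s x) has_vector_derivative X (\<Phi> t x)) (at t)))"

definition projective_vector_field ::
  "(real^'n::finite) set \<Rightarrow> 'n tensor2 \<Rightarrow> (real^'n \<Rightarrow> real^'n) \<Rightarrow> bool" where
  "projective_vector_field U g X \<longleftrightarrow> smooth_on X U \<and>
     (\<forall>V \<epsilon> \<Phi>. local_flow U X V \<epsilon> \<Phi> \<longrightarrow> (\<forall>t\<in>{-\<epsilon><..<\<epsilon>}. \<forall>T \<gamma>.
        unparametrized_geodesic V g T \<gamma> \<longrightarrow> unparametrized_geodesic U g T (\<Phi> t \<circ> \<gamma>)))"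

definition lie_derivative_metric ::
  "(real^'n::finite \<Rightarrow> real^'n) \<Rightarrow> 'n tensor2 \<Rightarrow> 'n tensor2" where
  "lie_derivative_metric X g x = (\<chi> i j. \<Sum>k\<in>UNIV.
       X x $ k * pd k (\<lambda>z. g z $ i $ j) x
     + g x $ k $ j * pd i (\<lambda>z. X z $ k) x
     + g x $ i $ k * pd j (\<lambda>z. X z $ k) x)"

definition homothetic :: "(real^'n::finite) set \<Rightarrow> 'n tensor2 \<Rightarrow> (real^'n \<Rightarrow> real^'n) \<Rightarrow> bool" where
  "homothetic U g X \<longleftrightarrow> (\<exists>c. \<forall>x\<in>U. lie_derivative_metric X g x = c *\<^sub>R g x)"

definition essential :: "(real^'n::finite) set \<Rightarrow> 'n tensor2 \<Rightarrow> (real^'n \<Rightarrow> real^'n) \<Rightarrow> bool" where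
  "essential U g X \<longleftrightarrow> \<not> homothetic U g X"


section \<open>Hamiltonian systems\<close>

text \<open>A point of the cotangent bundle over a chart is a pair \<open>(x, p)\<close> of position and momentum.\<close>

definition poisson ::
  "((real^'n::finite) \<times> (real^'n) \<Rightarrow> real) \<Rightarrow> ((real^'n) \<times> (real^'n) \<Rightarrow> real) \<Rightarrow> (real^'n) \<times> (real^'n) \<Rightarrow> real" where
  "poisson F G z = (\<Sum>i\<in>UNIV.
       frechet_derivative F (at z) (axis i 1, 0) * frechet_derivative G (at z) (0, axis i 1)
     - frechet_derivative F (at z) (0, axis i 1) * frechet_derivative G (at z) (axis i 1, 0))"

definition integral_of_motion ::
  "(real^'n::finite) set \<Rightarrow> ((real^'n) \<times> (real^'n) \<Rightarrow> real) \<Rightarrow> ((real^'n) \<times> (real^'n) \<Rightarrow> real) \<Rightarrow> bool" where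
  "integral_of_motion U H F \<longleftrightarrow> smooth_on F (U \<times> UNIV) \<and> (\<forall>z\<in>U \<times> UNIV. poisson F H z = 0)"

text \<open>Generic points are the points of an open dense subset.\<close>

definition functionally_independent ::
  "'a::real_normed_vector set \<Rightarrow> ('a \<Rightarrow> real) list \<Rightarrow> bool" where
  "functionally_independent S Fs \<longleftrightarrow> (\<exists>D. open D \<and> D \<subseteq> S \<and> S \<subseteq> closure D \<and>
     (\<forall>z\<in>D. \<forall>c. (\<forall>v. (\<Sum>i<length Fs. c i * frechet_derivative (Fs ! i) (at z) v) = 0)
        \<longrightarrow> (\<forall>i<length Fs. c i = 0)))"

definition maximally_superintegrable ::
  "(real^'n::finite) set \<Rightarrow> ((real^'n) \<times> (real^'n) \<Rightarrow> real) \<Rightarrow> ((real^'n) \<times> (real^'n) \<Rightarrow> real) list \<Rightarrow> bool" where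
  "maximally_superintegrable U H Fs \<longleftrightarrow>
     length Fs = 2 * CARD('n) - 1 \<and> H \<in> set Fs \<and>
     (\<forall>F\<in>set Fs. integral_of_motion U H F) \<and> functionally_independent (U \<times> UNIV) Fs"

definition quadratic_in_momenta ::
  "(real^'n::finite) set \<Rightarrow> ((real^'n) \<times> (real^'n) \<Rightarrow> real) \<Rightarrow> bool" where
  "quadratic_in_momenta U F \<longleftrightarrow> (\<exists>A b c. \<forall>x\<in>U. \<forall>p. F (x, p) = p \<bullet> (A x *v p) + b x \<bullet> p + c x)"

definition kinetic_hamiltonian :: "'n::finite tensor2 \<Rightarrow> (real^'n) \<times> (real^'n) \<Rightarrow> real" where
  "kinetic_hamiltonian g = (\<lambda>(x, p). 1/2 * (p \<bullet> (matrix_inv (g x) *v p)))"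

definition free_second_order_superintegrable ::
  "(real^'n::finite) set \<Rightarrow> 'n tensor2 \<Rightarrow> ((real^'n) \<times> (real^'n) \<Rightarrow> real) list \<Rightarrow> bool" where
  "free_second_order_superintegrable U g Fs \<longleftrightarrow>
     maximally_superintegrable U (kinetic_hamiltonian g) Fs \<and> (\<forall>F\<in>set Fs. quadratic_in_momenta U F)"

definition killing_tensor_of :: "2 tensor2 \<Rightarrow> 2 tensor2 \<Rightarrow> 2 tensor2" where
  "killing_tensor_of g g' x = (\<bar>det (g x) / det (g' x)\<bar> powr (2/3)) *\<^sub>R g' x"

text \<open>The function \<open>K\<^sup>i\<^sup>j p\<^sub>i p\<^sub>j\<close>, both indices of \<open>K\<close> being raised with \<open>g\<close>.\<close>

definition associated_integral :: "2 tensor2 \<Rightarrow> 2 tensor2 \<Rightarrow> (real^2) \<times> (real^2) \<Rightarrow> real" where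
  "associated_integral g g' = (\<lambda>(x, p).
     p \<bullet> ((matrix_inv (g x) ** killing_tensor_of g g' x ** matrix_inv (g x)) *v p))"


section \<open>The three metrics\<close>

text \<open>The coordinates \<open>(x, y)\<close> are the components \<open>z $ 1, z $ 2\<close>. A term \<open>f dx dy\<close> is a symmetric
  product, so it contributes \<open>f / 2\<close> to each off-diagonal entry.\<close>

definition quadratic_form :: "real \<Rightarrow> real \<Rightarrow> real \<Rightarrow> real^2^2" where
  "quadratic_form a b c = vector [vector [a, b / 2], vector [b / 2, c]]"

definition g1 :: "2 tensor2" where
  "g1 z = (let x = z $ 1; y = z $ 2 in quadratic_form 0 (y^2 + x) 0)"

definition g2 :: "2 tensor2" where
  "g2 z = (let x = z $ 1; y = z $ 2 in
     quadratic_form 0 (- 2 * ((y^2 + x) / y^3)) ((y^2 + x)^2 / y^4))"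

definition g3 :: "2 tensor2" where
  "g3 z = (let x = z $ 1; y = z $ 2 in
     ((y^2 + x) / (3 * x - y^2)^6) *\<^sub>R
     quadratic_form (9 * (y^2 + x)) (- 4 * y * (9 * x + y^2)) (12 * x * (y^2 + x)))"

text \<open>The points where all three expressions are defined and nondegenerate;
  note \<open>det (g3 z) = 4 (y\<^sup>2 + x)\<^sup>2 / (3 x - y\<^sup>2)\<^sup>9\<close>.\<close>

definition regular_points :: "(real^2) set" where
  "regular_points = {z. z $ 2 \<noteq> 0 \<and> (z $ 2)^2 + z $ 1 \<noteq> 0 \<and> 3 * z $ 1 - (z $ 2)^2 \<noteq> 0}"

end

theory Submission
  imports Defs "HOL-Computational_Algebra.Polynomial"
begin

text \<open>
  Put \<open>w = y\<^sup>2 + x\<close> and \<open>\<sigma> = w\<^sup>-\<^sup>1\<^sup>/\<^sup>3 S\<close>. Up to constant factors (one of which is the sign of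
  \<open>3 x - y\<^sup>2\<close>, constant on a connected domain), the tensors \<open>\<sigma>\<^sub>1\<close>, \<open>\<sigma>\<^sub>2\<close>, \<open>\<sigma>\<^sub>3\<close> become symmetric matrices
  with polynomial entries, the members of a three-parameter linear family \<open>S\<^sub>n\<close>. The metrizability
  equation expresses the derivatives of \<open>S\<^sub>n\<close> linearly by \<open>S\<^sub>n\<close> itself and a vector \<open>\<lambda>\<close>, see
  \<open>sol_xx_deriv\<close>, \<open>sol_xy_deriv\<close> and \<open>sol_yy_deriv\<close>.

  Let \<open>\<sigma>\<close>, \<open>\<sigma>'\<close> belong to the parameters \<open>m\<close>, \<open>n\<close>, let \<open>v = S\<^sub>m p\<close> and
  \<open>F\<^sub>n = v \<cdot> adj(S\<^sub>n) v / w\<close>. In the Hamiltonian of \<open>g\<close> and in the integral associated to \<open>g'\<close> all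
  fractional powers cancel, and they turn out to be \<open>\<plusminus>F\<^sub>m / 2\<close> and \<open>\<plusminus>F\<^sub>n\<close> with locally constant signs
  (\<open>kinetic_hamiltonian_polar\<close>, \<open>associated_integral_polar\<close>). The function \<open>F\<^sub>n\<close> is linear in \<open>n\<close>, and
  the parameters of \<open>\<sigma>\<close>, \<open>\<sigma>bar\<close>, \<open>\<sigma>hat\<close> are linearly independent because their coefficient vectors
  with respect to \<open>\<sigma>\<^sub>1\<close>, \<open>\<sigma>\<^sub>2\<close>, \<open>\<sigma>\<^sub>3\<close> form an orthonormal frame. Two facts about \<open>F\<^sub>n\<close> therefore suffice.

  First, \<open>F\<^sub>n\<close> Poisson-commutes with \<open>F\<^sub>m\<close>. After the derivatives of \<open>S\<^sub>m\<close>, \<open>S\<^sub>n\<close> have been replaced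
  by means of the metrizability equation, this is a polynomial identity in the values of \<open>S\<close>, \<open>\<lambda>\<close>, \<open>p\<close>
  at one point (\<open>polar_poisson_identity\<close>).

  Secondly, \<open>dF\<^sub>n = 0\<close> at a generic point only for \<open>n = 0\<close> (\<open>polar_integral_nondegenerate\<close>). At a
  fixed base point the linear functions \<open>n \<mapsto> F\<^sub>n\<close>, for varying \<open>p\<close>, lie on the cone dual to the
  quadratic form \<open>n \<mapsto> det S\<^sub>n\<close>, so independence can only come from the motion of this cone with the
  base point. Indeed, the momentum part of \<open>dF\<^sub>n\<close> vanishes exactly when \<open>adj(S\<^sub>n) v = 0\<close>, that is,
  when \<open>S\<^sub>n\<close> is a multiple of \<open>v v\<^sup>T\<close> at the point; and for \<open>S\<^sub>n = v v\<^sup>T\<close> the position part is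
  \<open>\<lambda>\<^sub>x v\<^sub>y - \<lambda>\<^sub>y v\<^sub>x\<close> times the nonzero vector \<open>2 (v\<^sub>y, - v\<^sub>x) / w\<close>. The first factor is a cubic form in
  \<open>v\<close> that is nonzero over every base point, so its zeros have a dense open complement.
\<close>

section \<open>Smooth functions\<close>

lemma Ck_on_cong:
  assumes "open S" and "\<And>x. x \<in> S \<Longrightarrow> f x = g x" and "Ck_on k f S"
  shows "Ck_on k g S"
  using assms(2,3)
proof (induction k arbitrary: f g)
  case 0
  then show ?case
    by (simp cong: continuous_on_cong)
next
  case (Suc k)
  have deriv: "(g has_derivative frechet_derivative f (at x)) (at x)" if "x \<in> S" for x
  proof (rule has_derivative_transform_within_open[OF _ \<open>open S\<close> that])
    show "(f has_derivative frechet_derivative f (at x)) (at x)"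
      using Suc.prems that by (simp add: frechet_derivative_works)
  qed (rule Suc.prems)
  have "Ck_on k (\<lambda>x. frechet_derivative g (at x) b) S" if "b \<in> Basis" for b
  proof (rule Suc.IH)
    show "Ck_on k (\<lambda>x. frechet_derivative f (at x) b) S"
      using Suc.prems that by simp
    show "frechet_derivative f (at x) b = frechet_derivative g (at x) b" if "x \<in> S" for x
      using fun_cong[OF frechet_derivative_at[OF deriv[OF that]]] .
  qed
  then show ?case
    using deriv by (auto simp: differentiable_def)
qed

text \<open>The recursion in the definition of \<open>Ck_on\<close> runs through the chosen derivative
  \<open>frechet_derivative\<close>; this rule lets any explicit formula for the derivative on an open set take
  its place, which is what makes the induction steps below calculations.\<close>

lemma Ck_on_SucI:
  assumes "open S"
    and deriv: "\<And>x. x \<in> S \<Longrightarrow> (f has_derivative f' x) (at x)"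
    and "\<And>b. b \<in> Basis \<Longrightarrow> Ck_on k (\<lambda>x. f' x b) S"
  shows "Ck_on (Suc k) f S"
proof -
  have "Ck_on k (\<lambda>x. frechet_derivative f (at x) b) S" if "b \<in> Basis" for b
    by (rule Ck_on_cong[OF \<open>open S\<close> _ assms(3)[OF that]])
      (simp flip: frechet_derivative_at[OF deriv])
  then show ?thesis
    using deriv by (auto simp: differentiable_def)
qed

lemma Ck_on_Suc_has_derivative:
  "Ck_on (Suc k) f S \<Longrightarrow> x \<in> S \<Longrightarrow> (f has_derivative frechet_derivative f (at x)) (at x)"
  by (simp add: frechet_derivative_works)

lemma Ck_on_Suc_imp: "Ck_on (Suc k) f S \<Longrightarrow> Ck_on k f S"
proof (induction k arbitrary: f)
  case 0
  then show ?case
    by (simp add: continuous_at_imp_continuous_on differentiable_imp_continuous_within)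
next
  case (Suc k)
  have "(\<forall>x\<in>S. f differentiable at x) \<and>
    (\<forall>b\<in>Basis. Ck_on (Suc k) (\<lambda>x. frechet_derivative f (at x) b) S)"
    by (rule iffD1[OF Ck_on.simps(2) Suc.prems])
  with Suc.IH show ?case
    unfolding Ck_on.simps(2)[of k] by blast
qed

lemma Ck_on_const: "Ck_on k (\<lambda>_. c) S"
  by (induction k arbitrary: c) (auto simp: continuous_on_const)

lemma Ck_on_bounded_linear:
  assumes "open S" and "bounded_linear f"
  shows "Ck_on k f S"
proof (cases k)
  case 0
  then show ?thesis
    using assms by (auto intro: linear_continuous_on)
next
  case (Suc k)
  show ?thesis
    unfolding Suc by (rule Ck_on_SucI[OF \<open>open S\<close>, where f' = "\<lambda>_. f"])
      (auto intro: Ck_on_const bounded_linear_imp_has_derivative assms)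
qed

lemma Ck_on_add:
  assumes "open S" "Ck_on k f S" "Ck_on k g S"
  shows "Ck_on k (\<lambda>x. f x + g x) S"
  using assms(2,3)
proof (induction k arbitrary: f g)
  case 0
  then show ?case by (simp add: continuous_on_add continuous_on_mult)
next
  case (Suc k)
  have "((\<lambda>x. f x + g x) has_derivative
      (\<lambda>b. frechet_derivative f (at x) b + frechet_derivative g (at x) b)) (at x)"
    if "x \<in> S" for x
    using has_derivative_add Ck_on_Suc_has_derivative Suc.prems that by blast
  moreover have "Ck_on k (\<lambda>x. frechet_derivative f (at x) b + frechet_derivative g (at x) b) S"
    if "b \<in> Basis" for b
    using Suc that by simp
  ultimately show ?case
    by (rule Ck_on_SucI[OF \<open>open S\<close>])
qed

lemma Ck_on_mult:
  fixes f g :: "'a::euclidean_space \<Rightarrow> real"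
  assumes "open S" "Ck_on k f S" "Ck_on k g S"
  shows "Ck_on k (\<lambda>x. f x * g x) S"
  using assms(2,3)
proof (induction k arbitrary: f g)
  case 0
  then show ?case by (simp add: continuous_on_add continuous_on_mult)
next
  case (Suc k)
  have "Ck_on k f S" "Ck_on k g S"
    by (rule Ck_on_Suc_imp, fact Suc.prems)+
  then have "Ck_on k (\<lambda>x. f x * frechet_derivative g (at x) b
      + frechet_derivative f (at x) b * g x) S" if "b \<in> Basis" for b
    using Suc.prems that by (intro Ck_on_add[OF \<open>open S\<close>] Suc.IH) auto
  moreover have "((\<lambda>x. f x * g x) has_derivative
      (\<lambda>b. f x * frechet_derivative g (at x) b + frechet_derivative f (at x) b * g x)) (at x)"
    if "x \<in> S" for x
    using has_derivative_mult Ck_on_Suc_has_derivative Suc.prems that by blast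
  ultimately show ?case
    by (intro Ck_on_SucI[OF \<open>open S\<close>])
qed

lemma Ck_on_inverse:
  fixes f :: "'a::euclidean_space \<Rightarrow> real"
  assumes "open S" and nz: "\<And>x. x \<in> S \<Longrightarrow> f x \<noteq> 0" and "Ck_on k f S"
  shows "Ck_on k (\<lambda>x. inverse (f x)) S"
  using assms(3)
proof (induction k)
  case 0
  then show ?case using nz by (simp add: continuous_on_inverse)
next
  case (Suc k)
  let ?d = "\<lambda>x b. (- 1) * (inverse (f x) * frechet_derivative f (at x) b * inverse (f x))"
  have "Ck_on k (\<lambda>x. inverse (f x)) S"
    by (rule Suc.IH, rule Ck_on_Suc_imp, fact Suc.prems)
  then have "Ck_on k (\<lambda>x. ?d x b) S" if "b \<in> Basis" for b
    using Suc.prems that by (intro Ck_on_mult[OF \<open>open S\<close>] Ck_on_const) auto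
  moreover have "((\<lambda>x. inverse (f x)) has_derivative ?d x) (at x)" if "x \<in> S" for x
    using Deriv.has_derivative_inverse[OF nz[OF that] Ck_on_Suc_has_derivative[OF Suc.prems that]]
    by simp
  ultimately show ?case
    by (rule Ck_on_SucI[OF \<open>open S\<close>, rotated])
qed

section \<open>The space of solutions\<close>

definition conformal_factor :: "real^2 \<Rightarrow> real" where
  "conformal_factor z = (z$2)^2 + z$1"

text \<open>The entries of \<open>w\<^sup>1\<^sup>/\<^sup>3 \<sigma>\<close>, where \<open>w = y\<^sup>2 + x\<close> and \<open>\<sigma>\<close> runs through the solutions of the
  metrizability equation. The three parameters are the coefficients of \<open>\<sigma>\<^sub>1\<close>, \<open>\<sigma>\<^sub>2\<close>, \<open>\<sigma>\<^sub>3\<close>,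
  rescaled so that the entries are polynomials with integer coefficients.\<close>

definition sol_xx :: "real^3 \<Rightarrow> real^2 \<Rightarrow> real" where
  "sol_xx n z = conformal_factor z * (12 * n$3 * z$1 - n$2)"

definition sol_xy :: "real^3 \<Rightarrow> real^2 \<Rightarrow> real" where
  "sol_xy n z = n$1 - n$2 * z$2 + 2 * n$3 * z$2 * (9 * z$1 + (z$2)^2)"

definition sol_yy :: "real^3 \<Rightarrow> real^2 \<Rightarrow> real" where
  "sol_yy n z = 9 * n$3 * conformal_factor z"

text \<open>The trace part \<open>\<lambda>\<^sup>a = 1/3 \<nabla>\<^sub>i \<sigma>\<^sup>i\<^sup>a\<close> of the covariant derivative, multiplied by the same factor
  \<open>w\<^sup>1\<^sup>/\<^sup>3\<close>.\<close>

definition lam_x :: "real^3 \<Rightarrow> real^2 \<Rightarrow> real" where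
  "lam_x n z = - n$2 + n$3 * (18 * z$1 + 6 * (z$2)^2)"

definition lam_y :: "real^3 \<Rightarrow> real^2 \<Rightarrow> real" where
  "lam_y n z = 18 * n$3 * z$2"

definition sol_det :: "real^3 \<Rightarrow> real^2 \<Rightarrow> real" where
  "sol_det n z = sol_xx n z * sol_yy n z - (sol_xy n z)^2"

lemma conformal_factor_deriv:
  "(conformal_factor has_derivative (\<lambda>h. h$1 + 2 * z$2 * h$2)) (at z)"
  unfolding conformal_factor_def[abs_def]
  by (auto intro!: derivative_eq_intros bounded_linear_imp_has_derivative)

text \<open>The next three lemmas are the metrizability equation
  \<open>\<nabla>\<^sub>a \<sigma>\<^sup>b\<^sup>c = \<delta>\<^sub>a\<^sup>b \<lambda>\<^sup>c + \<delta>\<^sub>a\<^sup>c \<lambda>\<^sup>b\<close> for the Levi-Civita connection of \<open>w dx dy\<close>, whose only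
  nonzero Christoffel symbols are \<open>1 / w\<close> for \<open>xxx\<close> and \<open>2 y / w\<close> for \<open>yyy\<close>. The
  weight term of \<open>\<nabla>\<close> and the factor \<open>w\<^sup>1\<^sup>/\<^sup>3\<close> are included. The lemmas express the derivatives of
  the entries by the entries and \<open>\<lambda>\<close>, so that the Poisson bracket can be computed without the
  explicit polynomials.\<close>

lemma sol_xx_deriv:
  assumes "conformal_factor z \<noteq> 0"
  shows "(sol_xx n has_derivative
    (\<lambda>h. (2 * lam_x n z - sol_xx n z / conformal_factor z) * h$1
       + 2 * z$2 / conformal_factor z * sol_xx n z * h$2)) (at z)"
  unfolding sol_xx_def[abs_def]
  apply (rule derivative_eq_intros conformal_factor_deriv bounded_linear_imp_has_derivative
      bounded_linear_vec_nth refl)+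
  using assms by (simp add: fun_eq_iff lam_x_def) (simp add: conformal_factor_def algebra_simps)

lemma sol_xy_deriv: "(sol_xy n has_derivative (\<lambda>h. lam_y n z * h$1 + lam_x n z * h$2)) (at z)"
  unfolding sol_xy_def[abs_def]
  apply (rule derivative_eq_intros bounded_linear_imp_has_derivative bounded_linear_vec_nth refl)+
  by (simp add: fun_eq_iff lam_x_def lam_y_def algebra_simps power2_eq_square)

lemma sol_yy_deriv:
  assumes "conformal_factor z \<noteq> 0"
  shows "(sol_yy n has_derivative
    (\<lambda>h. sol_yy n z / conformal_factor z * h$1
       + (2 * lam_y n z - 2 * z$2 / conformal_factor z * sol_yy n z) * h$2)) (at z)"
  unfolding sol_yy_def[abs_def]
  apply (rule derivative_eq_intros conformal_factor_deriv bounded_linear_imp_has_derivative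
      bounded_linear_vec_nth refl)+
  using assms by (simp add: fun_eq_iff lam_y_def) (simp add: algebra_simps)

section \<open>The integrals as polarised determinants\<close>

text \<open>The vector \<open>v = S\<^sub>m p\<close>, and below it \<open>adj(S\<^sub>n) v\<close>, where \<open>S\<^sub>n\<close> denotes the symmetric matrix with
  the entries above.\<close>

definition vel_x :: "real^3 \<Rightarrow> real^2 \<Rightarrow> real^2 \<Rightarrow> real" where
  "vel_x m z p = sol_xx m z * p$1 + sol_xy m z * p$2"

definition vel_y :: "real^3 \<Rightarrow> real^2 \<Rightarrow> real^2 \<Rightarrow> real" where
  "vel_y m z p = sol_xy m z * p$1 + sol_yy m z * p$2"

definition res_x :: "real^3 \<Rightarrow> real^3 \<Rightarrow> real^2 \<Rightarrow> real^2 \<Rightarrow> real" where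
  "res_x m n z p = sol_yy n z * vel_x m z p - sol_xy n z * vel_y m z p"

definition res_y :: "real^3 \<Rightarrow> real^3 \<Rightarrow> real^2 \<Rightarrow> real^2 \<Rightarrow> real" where
  "res_y m n z p = sol_xx n z * vel_y m z p - sol_xy n z * vel_x m z p"

text \<open>The function \<open>v \<cdot> adj(S\<^sub>n) v / w\<close>. The numerator is the polarisation of the determinant,
  evaluated at \<open>S\<^sub>n\<close> and the rank-one matrix \<open>v v\<^sup>T\<close>.\<close>

definition polar_integral :: "real^3 \<Rightarrow> real^3 \<Rightarrow> (real^2) \<times> (real^2) \<Rightarrow> real" where
  "polar_integral m n = (\<lambda>(z, p).
     (res_x m n z p * vel_x m z p + res_y m n z p * vel_y m z p) / conformal_factor z)"

text \<open>The four partial derivatives of \<open>polar_integral m n\<close>, after the derivatives of the entries have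
  been replaced by means of the metrizability equation.\<close>

definition dx_polar :: "real^3 \<Rightarrow> real^3 \<Rightarrow> real^2 \<Rightarrow> real^2 \<Rightarrow> real" where
  "dx_polar m n z p = (let w = conformal_factor z; v = vel_x m z p; u = vel_y m z p;
       r = res_x m n z p; s = res_y m n z p in
     (sol_yy n z / w * v^2 - 2 * lam_y n z * v * u + (2 * lam_x n z - sol_xx n z / w) * u^2
      + 2 * (r * ((2 * lam_x m z - sol_xx m z / w) * p$1 + lam_y m z * p$2)
           + s * (lam_y m z * p$1 + sol_yy m z / w * p$2))) / w
     - (r * v + s * u) / w^2)"

definition dy_polar :: "real^3 \<Rightarrow> real^3 \<Rightarrow> real^2 \<Rightarrow> real^2 \<Rightarrow> real" where
  "dy_polar m n z p = (let w = conformal_factor z; y = z$2; v = vel_x m z p; u = vel_y m z p;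
       r = res_x m n z p; s = res_y m n z p in
     ((2 * lam_y n z - 2 * y / w * sol_yy n z) * v^2 - 2 * lam_x n z * v * u
      + 2 * y / w * sol_xx n z * u^2
      + 2 * (r * (2 * y / w * sol_xx m z * p$1 + lam_x m z * p$2)
           + s * (lam_x m z * p$1 + (2 * lam_y m z - 2 * y / w * sol_yy m z) * p$2))) / w
     - 2 * y * (r * v + s * u) / w^2)"

definition dp_polar :: "real^3 \<Rightarrow> real^3 \<Rightarrow> real^2 \<Rightarrow> real^2 \<Rightarrow> real" where
  "dp_polar m n z p
     = 2 * (sol_xx m z * res_x m n z p + sol_xy m z * res_y m n z p) / conformal_factor z"

definition dq_polar :: "real^3 \<Rightarrow> real^3 \<Rightarrow> real^2 \<Rightarrow> real^2 \<Rightarrow> real" where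
  "dq_polar m n z p
     = 2 * (sol_xy m z * res_x m n z p + sol_yy m z * res_y m n z p) / conformal_factor z"

lemma polar_integral_deriv:
  assumes "conformal_factor z \<noteq> 0"
  shows "(polar_integral m n has_derivative
    (\<lambda>(h, k). dx_polar m n z p * h$1 + dy_polar m n z p * h$2
       + dp_polar m n z p * k$1 + dq_polar m n z p * k$2)) (at (z, p))"
proof -
  have base: "((\<lambda>a. f (fst a)) has_derivative (\<lambda>a. f' (fst a))) (at (z, p))"
    if "(f has_derivative f') (at z)" for f f' :: "real^2 \<Rightarrow> real"
    using has_derivative_compose[OF has_derivative_fst[OF has_derivative_ident], of f f' "(z, p)" UNIV]
      that by simp
  have mom: "((\<lambda>a. snd a $ i) has_derivative (\<lambda>a. snd a $ i)) (at (z, p))" for i :: 2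
    by (intro bounded_linear_imp_has_derivative bounded_linear_compose[OF bounded_linear_vec_nth]
        bounded_linear_snd)
  note derivs = base[OF sol_xx_deriv[OF assms]] base[OF sol_xy_deriv] base[OF sol_yy_deriv[OF assms]]
    base[OF conformal_factor_deriv] mom
  show ?thesis
    unfolding polar_integral_def case_prod_beta res_x_def res_y_def vel_x_def vel_y_def
    apply (rule derivative_eq_intros derivs refl | simp add: assms)+
    using assms
    apply (simp add: fun_eq_iff dx_polar_def dy_polar_def dp_polar_def dq_polar_def Let_def
        res_x_def res_y_def vel_x_def vel_y_def)
    apply (simp add: divide_simps)
    by algebra
qed

text \<open>The Poisson bracket of \<open>polar_integral m n\<close> and \<open>polar_integral m m\<close> at one point, cleared of
  denominators. Here \<open>a, b, c\<close> and \<open>l, k\<close> are the entries of \<open>S\<^sub>m\<close> and the components of its \<open>\<lambda>\<close>,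
  capital letters are the same data for \<open>n\<close>, and \<open>p, q\<close> are the momenta. The identity holds for
  arbitrary values of all of these, so the bracket vanishes as a consequence of the metrizability
  equation.\<close>

lemma polar_poisson_identity:
  fixes w a b c A B C p q l k L K y :: real
  assumes "w \<noteq> 0"
  defines "v \<equiv> a * p + b * q" and "u \<equiv> b * p + c * q"
  defines "ax \<equiv> 2 * l - a / w" and "cx \<equiv> c / w"
    and "ay \<equiv> 2 * y / w * a" and "cy \<equiv> 2 * k - 2 * y / w * c"
    and "Ax \<equiv> 2 * L - A / w" and "Cx \<equiv> C / w"
    and "Ay \<equiv> 2 * y / w * A" and "Cy \<equiv> 2 * K - 2 * y / w * C"
  defines "r \<equiv> C * v - B * u" and "s \<equiv> A * u - B * v"
    and "t \<equiv> c * v - b * u" and "e \<equiv> a * u - b * v"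
  defines "Fx \<equiv> (Cx * v^2 - 2 * K * v * u + Ax * u^2
      + 2 * (r * (ax * p + k * q) + s * (k * p + cx * q))) * w - (r * v + s * u)"
    and "Fy \<equiv> (Cy * v^2 - 2 * L * v * u + Ay * u^2
      + 2 * (r * (ay * p + l * q) + s * (l * p + cy * q))) * w - 2 * y * (r * v + s * u)"
    and "Hx \<equiv> (cx * v^2 - 2 * k * v * u + ax * u^2
      + 2 * (t * (ax * p + k * q) + e * (k * p + cx * q))) * w - (t * v + e * u)"
    and "Hy \<equiv> (cy * v^2 - 2 * l * v * u + ay * u^2
      + 2 * (t * (ay * p + l * q) + e * (l * p + cy * q))) * w - 2 * y * (t * v + e * u)"
  shows "Fx * (a * t + b * e) + Fy * (b * t + c * e)
    - (a * r + b * s) * Hx - (b * r + c * s) * Hy = 0"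
proof -
  \<comment> \<open>Multiplied by \<open>w\<close>, the substituted derivatives are polynomials.\<close>
  have clear: "w * ax = 2 * l * w - a" "w * cx = c" "w * ay = 2 * y * a" "w * cy = 2 * k * w - 2 * y * c"
    "w * Ax = 2 * L * w - A" "w * Cx = C" "w * Ay = 2 * y * A" "w * Cy = 2 * K * w - 2 * y * C"
    using assms by (simp_all add: assms field_simps)
  show ?thesis
    using clear unfolding Fx_def Fy_def Hx_def Hy_def r_def s_def t_def e_def v_def u_def
    by algebra
qed

lemma frechet_polar_integral:
  assumes "conformal_factor z \<noteq> 0"
  shows "frechet_derivative (polar_integral m n) (at (z, p)) (h, k)
    = dx_polar m n z p * h$1 + dy_polar m n z p * h$2
       + dp_polar m n z p * k$1 + dq_polar m n z p * k$2"
  using fun_cong[OF frechet_derivative_at[OF polar_integral_deriv[OF assms]], of m n p "(h, k)"]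
  by simp

lemma polar_integral_has_frechet_derivative:
  assumes "conformal_factor z \<noteq> 0"
  shows "(polar_integral m n has_derivative frechet_derivative (polar_integral m n) (at (z, p)))
    (at (z, p))"
  unfolding frechet_derivative_at[OF polar_integral_deriv[OF assms], symmetric]
  by (rule polar_integral_deriv[OF assms])

lemma poisson_polar_integral:
  assumes "conformal_factor z \<noteq> 0"
  shows "poisson (polar_integral m n) (polar_integral m m) (z, p) = 0"
proof -
  define w where "w = conformal_factor z"
  let ?Fx = "dx_polar m n z p" and ?Fy = "dy_polar m n z p"
  let ?Hx = "dx_polar m m z p" and ?Hy = "dy_polar m m z p"
  have w: "w \<noteq> 0"
    using assms by (simp add: w_def)
  have scale: "w\<^sup>2 * (A / w - B / w\<^sup>2) = A * w - B" for A B :: real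
    using w by (simp add: field_simps power2_eq_square)
  have scale': "w * (2 * A / w) / 2 = A" for A :: real
    using w by simp
  have "(w^2 * ?Fx) * (w * dp_polar m m z p / 2) + (w^2 * ?Fy) * (w * dq_polar m m z p / 2)
     - (w * dp_polar m n z p / 2) * (w^2 * ?Hx) - (w * dq_polar m n z p / 2) * (w^2 * ?Hy) = 0"
    using polar_poisson_identity[OF w, where a = "sol_xx m z" and b = "sol_xy m z" and c = "sol_yy m z"
        and A = "sol_xx n z" and B = "sol_xy n z" and C = "sol_yy n z" and p = "p$1" and q = "p$2"
        and l = "lam_x m z" and k = "lam_y m z" and L = "lam_x n z" and K = "lam_y n z" and y = "z$2"]
    unfolding dx_polar_def dy_polar_def dp_polar_def dq_polar_def Let_def w_def[symmetric] scale scale'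
      res_x_def res_y_def vel_x_def vel_y_def .
  then have "w^3 / 2 * (?Fx * dp_polar m m z p + ?Fy * dq_polar m m z p
     - dp_polar m n z p * ?Hx - dq_polar m n z p * ?Hy) = 0"
    by (simp add: algebra_simps power2_eq_square power3_eq_cube)
  moreover have "w^3 / 2 \<noteq> 0"
    using w by simp
  ultimately have "?Fx * dp_polar m m z p + ?Fy * dq_polar m m z p
     - dp_polar m n z p * ?Hx - dq_polar m n z p * ?Hy = 0"
    by (metis mult_eq_0_iff)
  then show ?thesis
    by (simp add: poisson_def UNIV_2 frechet_polar_integral[OF assms] axis_def algebra_simps)
qed

lemma polar_integral_add_scaleR:
  "polar_integral m (a *\<^sub>R n + b *\<^sub>R n') z
    = a * polar_integral m n z + b * polar_integral m n' z"
proof (cases z)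
  case (Pair x p)
  have "res_x m (a *\<^sub>R n + b *\<^sub>R n') x p = a * res_x m n x p + b * res_x m n' x p"
    and "res_y m (a *\<^sub>R n + b *\<^sub>R n') x p = a * res_y m n x p + b * res_y m n' x p"
    by (simp_all add: res_x_def res_y_def sol_xx_def sol_xy_def sol_yy_def algebra_simps)
  then show ?thesis
    using Pair by (simp add: polar_integral_def add_divide_distrib algebra_simps)
qed

lemma smooth_on_polar_integral:
  assumes "open U" and "\<And>z. z \<in> U \<Longrightarrow> conformal_factor z \<noteq> 0"
  shows "smooth_on (polar_integral m n) (U \<times> UNIV)"
proof -
  have U: "open (U \<times> (UNIV :: (real^2) set))"
    using assms(1) by (simp add: open_Times)
  have pos: "Ck_on k (\<lambda>a. fst a $ i) (U \<times> (UNIV :: (real^2) set))" for k i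
    by (intro Ck_on_bounded_linear[OF U] bounded_linear_compose[OF bounded_linear_vec_nth]
        bounded_linear_fst)
  have mom: "Ck_on k (\<lambda>a. snd a $ i) (U \<times> (UNIV :: (real^2) set))" for k i
    by (intro Ck_on_bounded_linear[OF U] bounded_linear_compose[OF bounded_linear_vec_nth]
        bounded_linear_snd)
  note arith = Ck_on_add[OF U] Ck_on_mult[OF U] Ck_on_const pos mom
  have diff: "Ck_on k (\<lambda>a. f a - g a) (U \<times> (UNIV :: (real^2) set))"
    if "Ck_on k f (U \<times> UNIV)" "Ck_on k g (U \<times> UNIV)" for k and f g :: "(real^2) \<times> (real^2) \<Rightarrow> real"
    using Ck_on_add[OF U that(1) Ck_on_mult[OF U Ck_on_const[of k "-1"] that(2)]] by simp
  have w: "Ck_on k (\<lambda>a. conformal_factor (fst a)) (U \<times> (UNIV :: (real^2) set))" for k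
    unfolding conformal_factor_def power2_eq_square by (intro arith)
  have inv: "Ck_on k (\<lambda>a. inverse (conformal_factor (fst a))) (U \<times> (UNIV :: (real^2) set))" for k
    using assms(2) by (intro Ck_on_inverse[OF U] w) auto
  show ?thesis
    unfolding smooth_on_def polar_integral_def case_prod_beta divide_inverse res_x_def res_y_def
      vel_x_def vel_y_def sol_xx_def sol_xy_def sol_yy_def power2_eq_square
    by (intro allI arith diff w inv)
qed

section \<open>Independence of the differentials\<close>

text \<open>The cubic form in \<open>v\<close> away from whose zeros the differentials are independent; it is
  \<open>w (\<lambda>\<^sub>x v\<^sub>y - \<lambda>\<^sub>y v\<^sub>x)\<close> for the solution that equals \<open>v v\<^sup>T\<close> at the given point.\<close>

definition cubic_form :: "real^3 \<Rightarrow> (real^2) \<times> (real^2) \<Rightarrow> real" where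
  "cubic_form m = (\<lambda>(z, p). vel_y m z p * ((vel_x m z p)^2 - 2 * z$2 * vel_x m z p * vel_y m z p
     + 2/3 * conformal_factor z * (vel_y m z p)^2))"

text \<open>If the momentum derivatives vanish then \<open>S\<^sub>m adj(S\<^sub>n) v = 0\<close>, so \<open>adj(S\<^sub>n) v = 0\<close>, and a symmetric
  matrix with this property is \<open>S\<^sub>n = k v v\<^sup>T\<close>. This determines \<open>n\<close> up to the factor \<open>k\<close>. All terms of
  the \<open>x\<close>-derivative that contain \<open>adj(S\<^sub>n) v\<close> drop out, and the remaining one is
  \<open>v \<cdot> adj(\<partial>\<^sub>x S\<^sub>n) v / w = 2 v\<^sub>y (\<lambda>\<^sub>x v\<^sub>y - \<lambda>\<^sub>y v\<^sub>x) / w\<close>, which is \<open>2 k v\<^sub>y / w\<^sup>2\<close> times the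
  cubic form. Hence \<open>k = 0\<close>.\<close>

lemma polar_integral_nondegenerate:
  assumes w: "conformal_factor z \<noteq> 0" and D: "sol_det m z \<noteq> 0"
    and cubic: "cubic_form m (z, p) \<noteq> 0"
    and d: "dx_polar m n z p = 0" "dp_polar m n z p = 0" "dq_polar m n z p = 0"
  shows "n = 0"
proof -
  let ?w = "conformal_factor z"
  define v u where "v = vel_x m z p" and "u = vel_y m z p"
  have eqs: "sol_xx m z * res_x m n z p + sol_xy m z * res_y m n z p = 0"
    "sol_xy m z * res_x m n z p + sol_yy m z * res_y m n z p = 0"
    using d(2,3) w by (simp_all add: dp_polar_def dq_polar_def)
  have "sol_det m z * res_x m n z p = 0" "sol_det m z * res_y m n z p = 0"
    using eqs unfolding sol_det_def by algebra+
  then have res: "res_x m n z p = 0" "res_y m n z p = 0"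
    using D by auto
  have u: "u \<noteq> 0"
    using cubic by (auto simp: cubic_form_def u_def)
  define k where "k = sol_yy n z / u^2"
  have yy: "sol_yy n z = k * u^2"
    using u by (simp add: k_def)
  have xy: "sol_xy n z = k * v * u"
    using res(1) u yy by (simp add: res_x_def flip: v_def u_def) (simp add: power2_eq_square mult_ac)
  have xx: "sol_xx n z = k * v^2"
    using res(2) u xy by (simp add: res_y_def flip: v_def u_def) (simp add: power2_eq_square)
  \<comment> \<open>Now \<open>S\<^sub>n = k v v\<^sup>T\<close>; read off the parameters, then \<open>\<lambda>\<close>.\<close>
  have n3: "n$3 * ?w = k * u^2 / 9"
    using yy by (simp add: sol_yy_def)
  have n2: "n$2 * ?w = 12 * (n$3 * ?w) * z$1 - k * v^2"
    using xx by (simp add: sol_xx_def algebra_simps)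
  have "?w * (sol_yy n z * v^2 - 2 * (lam_y n z * ?w) * v * u
      + (2 * (lam_x n z * ?w) - sol_xx n z) * u^2) = 0"
    using d(1) res w unfolding dx_polar_def Let_def by (simp add: field_simps v_def u_def)
  then have dx: "sol_yy n z * v^2 - 2 * (lam_y n z * ?w) * v * u
      + (2 * (lam_x n z * ?w) - sol_xx n z) * u^2 = 0"
    using w by (metis mult_eq_0_iff)
  have ly: "lam_y n z * ?w = 2 * k * u^2 * z$2"
    using n3 by (simp add: lam_y_def algebra_simps)
  have lx: "lam_x n z * ?w = k * (v^2 + 2/3 * ?w * u^2)"
  proof -
    have "lam_x n z * ?w = - (n$2 * ?w) + (n$3 * ?w) * (18 * z$1 + 6 * (z$2)^2)"
      by (simp add: lam_x_def algebra_simps)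
    then show ?thesis
      unfolding n2 n3 by (simp add: conformal_factor_def algebra_simps)
  qed
  have "2 * k * u * (u * (v^2 - 2 * z$2 * v * u + 2/3 * ?w * u^2)) = 0"
    using dx unfolding ly lx yy xx by algebra
  then have "k = 0"
    using cubic u by (simp add: cubic_form_def u_def v_def)
  then have "n$3 = 0" "n$2 = 0"
    using n3 n2 w by auto
  moreover have "n$1 = 0"
    using xy \<open>k = 0\<close> calculation by (simp add: sol_xy_def)
  ultimately show ?thesis
    by (simp add: vec_eq_iff forall_3)
qed

lemma dense_cubic_nonzero:
  assumes w: "conformal_factor z \<noteq> 0" and D: "sol_det m z \<noteq> 0" and "\<epsilon> > 0"
  obtains p' where "dist p' p < \<epsilon>" and "cubic_form m (z, p') \<noteq> 0"
proof -
  \<comment> \<open>The direction with \<open>S\<^sub>m q = (0, 1)\<close>; along it the cubic form is a polynomial in the parameter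
    with leading coefficient \<open>2 w / 3\<close>.\<close>
  define q :: "real^2" where
    "q = vector [- sol_xy m z / sol_det m z, sol_xx m z / sol_det m z]"
  define v u where "v = vel_x m z p" and "u = vel_y m z p"
  have vx: "vel_x m z (p + t *\<^sub>R q) = v" and vy: "vel_y m z (p + t *\<^sub>R q) = u + t" for t
    using D by (simp_all add: vel_x_def vel_y_def v_def u_def q_def field_simps)
      (simp_all add: sol_det_def algebra_simps power2_eq_square)
  define P where "P = [:0, v^2, - 2 * z$2 * v, 2/3 * conformal_factor z:]"
  have "finite {s. poly P s = 0}"
    using w by (intro poly_roots_finite) (simp add: P_def)
  then have fin: "finite ((\<lambda>s. s - u) ` {s. poly P s = 0})"
    by simp
  define \<delta> where "\<delta> = \<epsilon> / (norm q + 1)"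
  have "\<delta> > 0"
    using \<open>\<epsilon> > 0\<close> by (simp add: \<delta>_def add_nonneg_pos)
  then have "infinite {0<..<\<delta>}"
    by simp
  then obtain t where t: "t \<in> {0<..<\<delta>}" "t \<notin> (\<lambda>s. s - u) ` {s. poly P s = 0}"
    using fin by (meson finite_subset subsetI)
  have "poly P (u + t) \<noteq> 0"
    using t(2) by (auto simp: image_iff)
  moreover have "poly P (u + t)
      = (u + t) * (v^2 - 2 * z$2 * v * (u + t) + 2/3 * conformal_factor z * (u + t)^2)"
    by (simp add: P_def) algebra
  ultimately have "(u + t) * (v^2 - 2 * z$2 * v * (u + t) + 2/3 * conformal_factor z * (u + t)^2) \<noteq> 0"
    by metis
  show ?thesis
  proof
    have "norm (t *\<^sub>R q) \<le> t * (norm q + 1)"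
      using t by (simp add: algebra_simps)
    also have "\<dots> < \<delta> * (norm q + 1)"
      using t by (intro mult_strict_right_mono) (auto intro: add_nonneg_pos)
    also have "\<dots> = \<epsilon>"
      unfolding \<delta>_def using norm_ge_zero[of q] by (simp add: add_nonneg_eq_0_iff)
    finally show "dist (p + t *\<^sub>R q) p < \<epsilon>"
      by (simp add: dist_norm)
  qed (unfold cubic_form_def prod.case vx vy, fact)
qed

section \<open>Metrics in terms of their weighted tensors\<close>

definition adj2 :: "real^2^2 \<Rightarrow> real^2^2" where
  "adj2 A = vector [vector [A$2$2, - A$1$2], vector [- A$2$1, A$1$1]]"

lemma adj2_scaleR: "adj2 (c *\<^sub>R A) = c *\<^sub>R adj2 A"
  by (simp add: adj2_def vec_eq_iff forall_2)

lemma adj2_adj2: "adj2 (adj2 A) = A"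
  by (simp add: adj2_def vec_eq_iff forall_2)

lemma matrix_inv_adj2:
  assumes "det A \<noteq> 0"
  shows "matrix_inv A = (1 / det A) *\<^sub>R adj2 A"
proof -
  define B where "B = (1 / det A) *\<^sub>R adj2 A"
  have "A$1$1 * A$2$2 = det A + A$1$2 * A$2$1"
    by (simp add: det_2)
  then have B: "A ** B = mat 1" "B ** A = mat 1"
    using assms
    by (auto simp: B_def vec_eq_iff forall_2 matrix_matrix_mult_def mat_def adj2_def sum_2 field_simps)
  then have "A ** matrix_inv A = mat 1"
    unfolding matrix_inv_def by (metis (mono_tags, lifting) someI_ex)
  then have "matrix_inv A = B"
    using B(2) by (metis matrix_mul_assoc matrix_mul_lid matrix_mul_rid)
  then show ?thesis
    by (simp add: B_def)
qed

text \<open>Stated for an arbitrary cube root \<open>r\<close>, so that for a concrete metric it suffices to cube an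
  explicit expression instead of simplifying \<open>root 3\<close> of a determinant.\<close>

lemma sigma_of_eq:
  assumes "det (g x) \<noteq> 0" and "r ^ 3 = \<bar>det (g x)\<bar>"
  shows "sigma_of g x = (r / det (g x)) *\<^sub>R adj2 (g x)"
  using assms odd_real_root_unique[of 3 r "\<bar>det (g x)\<bar>"]
  by (simp add: sigma_of_def matrix_inv_adj2)

lemma det_scaleR_2: "det (c *\<^sub>R A) = c^2 * det A" for A :: "real^2^2"
  by (simp add: det_2 algebra_simps power2_eq_square)

lemma det_adj2: "det (adj2 A) = det A"
  by (simp add: det_2 adj2_def)

lemma sgn_det_sigma_of:
  assumes "det (g x) \<noteq> 0"
  shows "sgn (det (sigma_of g x)) = sgn (det (g x))"
proof -
  define r where "r = root 3 \<bar>det (g x)\<bar>"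
  have "r > 0" "r ^ 3 = \<bar>det (g x)\<bar>"
    using assms by (simp_all add: r_def odd_real_root_pow)
  then show ?thesis
    using assms by (simp add: sigma_of_eq det_scaleR_2 det_adj2 sgn_mult power2_eq_square)
qed

text \<open>The metric is recovered from \<open>\<sigma>\<close> by \<open>g\<^sup>i\<^sup>j = \<bar>det \<sigma>\<bar> \<sigma>\<^sup>i\<^sup>j\<close>.\<close>

lemma kinetic_hamiltonian_sigma:
  assumes "det (g x) \<noteq> 0"
  shows "kinetic_hamiltonian g (x, p)
    = \<bar>det (sigma_of g x)\<bar> / 2 * (p \<bullet> (sigma_of g x *v p))"
proof -
  define r where "r = root 3 \<bar>det (g x)\<bar>"
  have r: "r > 0" "r ^ 3 = \<bar>det (g x)\<bar>"
    using assms by (simp_all add: r_def odd_real_root_pow)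
  have "det (sigma_of g x) = r^2 / det (g x)"
    using assms r by (simp add: sigma_of_eq det_scaleR_2 det_adj2 power2_eq_square)
  then have "\<bar>det (sigma_of g x)\<bar> = r^2 / r^3"
    using r by (simp add: abs_divide)
  moreover have "matrix_inv (g x) = (1 / r) *\<^sub>R sigma_of g x"
    using r by (simp add: sigma_of_def flip: r_def)
  ultimately show ?thesis
    using r by (simp add: kinetic_hamiltonian_def scaleR_matrix_vector_assoc[symmetric]
        power2_eq_square power3_eq_cube)
qed

lemma sandwich_scaleR:
  fixes S T :: "real^2^2"
  shows "(a *\<^sub>R S) ** (b *\<^sub>R T) ** (a *\<^sub>R S) = (a * b * a) *\<^sub>R (S ** T ** S)"
  by (simp add: matrix_scalar_ac scalar_matrix_assoc[symmetric])

text \<open>In terms of \<open>\<sigma>\<close> the fractional powers of the two determinants cancel against those in the raised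
  indices: since \<open>g'\<close> is a multiple of \<open>adj \<sigma>'\<close>, only the sign of \<open>det \<sigma>'\<close> survives.\<close>

lemma associated_integral_sigma:
  assumes "det (g x) \<noteq> 0" and "det (g' x) \<noteq> 0"
  shows "associated_integral g g' (x, p) = sgn (det (sigma_of g' x)) *
    (p \<bullet> ((sigma_of g x ** adj2 (sigma_of g' x) ** sigma_of g x) *v p))"
proof -
  define r r' where "r = root 3 \<bar>det (g x)\<bar>" and "r' = root 3 \<bar>det (g' x)\<bar>"
  have r: "r > 0" "r ^ 3 = \<bar>det (g x)\<bar>" "r' > 0" "r' ^ 3 = \<bar>det (g' x)\<bar>"
    using assms by (simp_all add: r_def r'_def odd_real_root_pow)
  have G: "matrix_inv (g x) = (1 / r) *\<^sub>R sigma_of g x"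
    using r by (simp add: sigma_of_def flip: r_def)
  have g': "g' x = (det (g' x) / r') *\<^sub>R adj2 (sigma_of g' x)"
    using assms r by (simp add: sigma_of_eq[of g' x r'] adj2_scaleR adj2_adj2)
  have "\<bar>det (g x) / det (g' x)\<bar> = (r / r') ^ 3"
    using r by (simp add: abs_divide power_divide)
  also have "\<dots> powr (2/3) = (r / r') powr 2"
    using r by (simp add: powr_powr flip: powr_numeral)
  finally have "\<bar>det (g x) / det (g' x)\<bar> powr (2/3) = (r / r')^2"
    using r by simp
  then have "killing_tensor_of g g' x = ((r / r')^2 * (det (g' x) / r')) *\<^sub>R adj2 (sigma_of g' x)"
    by (simp only: killing_tensor_of_def) (subst g', simp)
  moreover have "det (g' x) / r' ^ 3 = sgn (det (g' x))"
    using assms by (simp add: r sgn_if)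
  moreover have "(1 / r) * ((r / r')^2 * (det (g' x) / r')) * (1 / r) = det (g' x) / r' ^ 3"
    using r(1,3) by (simp add: power2_eq_square power3_eq_cube)
  ultimately show ?thesis
    using assms(2)
    by (simp only: associated_integral_def G sandwich_scaleR sgn_det_sigma_of prod.case)
      (simp add: scaleR_matrix_vector_assoc[symmetric] sgn_det_sigma_of)
qed

definition solution :: "real^3 \<Rightarrow> real^2 \<Rightarrow> real^2^2" where
  "solution n z = vector [vector [sol_xx n z, sol_xy n z], vector [sol_xy n z, sol_yy n z]]"

lemma det_solution: "det (solution n z) = sol_det n z"
  by (simp add: solution_def det_2 sol_det_def power2_eq_square)

lemma solution_add_scaleR:
  "solution (a *\<^sub>R m + b *\<^sub>R n) z = a *\<^sub>R solution m z + b *\<^sub>R solution n z"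
  by (simp add: solution_def sol_xx_def sol_xy_def sol_yy_def vec_eq_iff forall_2 algebra_simps)

lemma polar_integral_solution:
  "p \<bullet> ((solution m z ** adj2 (solution n z) ** solution m z) *v p) / conformal_factor z
    = polar_integral m n (z, p)"
  by (simp add: polar_integral_def res_x_def res_y_def vel_x_def vel_y_def solution_def adj2_def
      inner_vec_def sum_2 matrix_vector_mult_def matrix_matrix_mult_def algebra_simps)

text \<open>For \<open>n = m\<close> the adjugate cancels: \<open>S adj(S) S = det(S) S\<close>.\<close>

lemma polar_integral_solution_self:
  "sol_det m z * (p \<bullet> (solution m z *v p)) / conformal_factor z = polar_integral m m (z, p)"
  by (simp add: polar_integral_def res_x_def res_y_def vel_x_def vel_y_def solution_def
      inner_vec_def sum_2 matrix_vector_mult_def sol_det_def algebra_simps power2_eq_square)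

section \<open>The weighted tensors of the three metrics\<close>

lemma sigma_of_g1:
  assumes "z \<in> regular_points"
  shows "sigma_of g1 z = inverse (root 3 (conformal_factor z)) *\<^sub>R solution (vector [2 / root 3 4, 0, 0]) z"
proof -
  define w c d where "w = conformal_factor z" and "c = root 3 w" and "d = root 3 (4::real)"
  have w: "w \<noteq> 0" "c ^ 3 = w" "c \<noteq> 0" "d^3 = 4" "d \<noteq> 0"
    using assms by (auto simp: regular_points_def w_def c_def d_def conformal_factor_def odd_real_root_pow)
  have c6: "c ^ 6 = w^2"
    using w by algebra
  have g1: "g1 z = quadratic_form 0 w 0"
    by (simp add: g1_def w_def conformal_factor_def Let_def)
  have det: "det (g1 z) = - (w^2 / 4)"
    by (simp add: g1 quadratic_form_def det_2 power2_eq_square)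
  have "(c^2 / d) ^ 3 = \<bar>det (g1 z)\<bar>"
    using w by (simp add: det power_divide c6)
  then have "sigma_of g1 z = (c^2 / d / det (g1 z)) *\<^sub>R adj2 (g1 z)"
    using w by (intro sigma_of_eq) (auto simp: det)
  also have "c^2 / d / det (g1 z) = - 4 / (c * d * w)"
  proof -
    have "c^2 * (c * d * w) * 4 = 4 * d * w^2"
      using w by algebra
    then show ?thesis
      using w by (simp add: det divide_simps)
  qed
  also have "\<dots> *\<^sub>R adj2 (g1 z) = (1 / c) *\<^sub>R solution (vector [2 / d, 0, 0]) z"
    using w(1,3,5) by (simp add: g1 vec_eq_iff forall_2 adj2_def solution_def sol_xx_def sol_xy_def sol_yy_def
        quadratic_form_def)
  finally show ?thesis
    by (simp add: c_def d_def w_def inverse_eq_divide)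
qed

lemma sigma_of_g2:
  assumes "z \<in> regular_points"
  shows "sigma_of g2 z = inverse (root 3 (conformal_factor z)) *\<^sub>R solution (vector [0, 1, 0]) z"
proof -
  define w c y where "w = conformal_factor z" and "c = root 3 w" and "y = z$2"
  have w: "w \<noteq> 0" "c ^ 3 = w" "c \<noteq> 0" "y \<noteq> 0"
    using assms by (auto simp: regular_points_def w_def c_def y_def conformal_factor_def odd_real_root_pow)
  have c6: "c ^ 6 = w^2"
    using w by algebra
  have g2: "g2 z = quadratic_form 0 (- 2 * (w / y^3)) (w^2 / y^4)"
    by (simp add: g2_def w_def y_def conformal_factor_def Let_def)
  have det: "det (g2 z) = - ((w / y^3)^2)"
    by (simp add: g2 quadratic_form_def det_2 power2_eq_square)
  have "(c^2 / y^2) ^ 3 = \<bar>det (g2 z)\<bar>"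
    using w by (simp add: det power_divide c6)
  then have "sigma_of g2 z = (c^2 / y^2 / det (g2 z)) *\<^sub>R adj2 (g2 z)"
    using w by (intro sigma_of_eq) (auto simp: det)
  also have "c^2 / y^2 / det (g2 z) = - (y^4) / (c * w)"
  proof -
    have "c^2 * (c * w) * y^6 = y^4 * (y^2 * w^2)"
      using w by algebra
    then show ?thesis
      using w by (simp add: det divide_simps)
  qed
  also have "\<dots> *\<^sub>R adj2 (g2 z) = (1 / c) *\<^sub>R solution (vector [0, 1, 0]) z"
    using w by (simp add: g2 vec_eq_iff forall_2 adj2_def solution_def sol_xx_def sol_xy_def sol_yy_def
        quadratic_form_def field_simps power2_eq_square power3_eq_cube power4_eq_xxxx
        flip: w_def y_def)
  finally show ?thesis
    by (simp add: c_def w_def inverse_eq_divide)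
qed

text \<open>The cube root of \<open>\<bar>det g3\<bar>\<close> contains \<open>\<bar>3 x - y\<^sup>2\<bar>\<^sup>3\<close>, while the inverse of \<open>g3\<close> contains
  \<open>(3 x - y\<^sup>2)\<^sup>3\<close>; this leaves the sign of \<open>3 x - y\<^sup>2\<close>.\<close>

lemma sigma_of_g3:
  assumes "z \<in> regular_points"
  shows "sigma_of g3 z = inverse (root 3 (conformal_factor z)) *\<^sub>R
    solution (vector [0, 0, sgn (3 * z$1 - (z$2)^2) * root 3 4 / 4]) z"
proof -
  define w c d u where "w = conformal_factor z" and "c = root 3 w" and "d = root 3 (4::real)"
    and "u = 3 * z$1 - (z$2)^2"
  have w: "w \<noteq> 0" "c ^ 3 = w" "c \<noteq> 0" "d^3 = 4" "d \<noteq> 0" "u \<noteq> 0"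
    using assms
    by (auto simp: regular_points_def w_def c_def d_def u_def conformal_factor_def odd_real_root_pow)
  have c6: "c ^ 6 = w^2"
    using w by algebra
  have g3: "g3 z = (w / u^6) *\<^sub>R
     quadratic_form (9 * w) (- 4 * z$2 * (9 * z$1 + (z$2)^2)) (12 * z$1 * w)"
    by (simp add: g3_def w_def u_def conformal_factor_def Let_def)
  \<comment> \<open>The determinant of the quadratic form in \<open>g3\<close> is \<open>4 (3 x - y\<^sup>2)\<^sup>3\<close>.\<close>
  have "9 * w * (12 * z$1 * w) - (2 * z$2 * (9 * z$1 + (z$2)^2))^2 = 4 * u^3"
    unfolding w_def u_def conformal_factor_def by algebra
  then have "det (g3 z) = (w / u^6)^2 * (4 * u^3)"
    by (simp add: g3 det_scaleR_2) (simp add: quadratic_form_def det_2 power2_eq_square)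
  also have "\<dots> = 4 * w^2 / u^9"
    using w by (simp add: power_divide divide_simps)
  finally have det: "det (g3 z) = 4 * w^2 / u^9" .
  have "(d * c^2 / \<bar>u\<bar>^3) ^ 3 = \<bar>det (g3 z)\<bar>"
    using w by (simp add: det power_divide power_mult_distrib c6 abs_divide power_abs)
     
  then have "sigma_of g3 z = (d * c^2 / \<bar>u\<bar>^3 / det (g3 z)) *\<^sub>R adj2 (g3 z)"
    using w by (intro sigma_of_eq) (auto simp: det)
  also have "d * c^2 / \<bar>u\<bar>^3 / det (g3 z) = sgn u * d / 4 / c * (u^6 / w)"
  proof -
    have "1 / \<bar>u\<bar>^3 = sgn u / u^3"
      using w by (cases "u > 0") (auto simp: sgn_if power3_eq_cube)
    then have "d * c^2 / \<bar>u\<bar>^3 / det (g3 z) = sgn u * d * (c^2 / u^3 / det (g3 z))"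
      by (metis (no_types, opaque_lifting) mult.assoc mult.commute times_divide_eq_left
          times_divide_eq_right mult_1)
    also have "c^2 / u^3 / det (g3 z) = u^6 / (4 * c * w)"
    proof -
      have "c^2 * (c * w) * u^9 = u^6 * (u^3 * w^2)"
        using w by algebra
      then show ?thesis
        using w by (simp add: det divide_simps)
    qed
    finally show ?thesis
      by simp
  qed
  also have "\<dots> *\<^sub>R adj2 (g3 z) = (1 / c) *\<^sub>R solution (vector [0, 0, sgn u * d / 4]) z"
    unfolding g3 adj2_scaleR using w
    by (simp add: vec_eq_iff forall_2 adj2_def solution_def sol_xx_def sol_xy_def sol_yy_def
        quadratic_form_def vector_3 w_def[symmetric])
  finally show ?thesis
    by (simp add: c_def d_def w_def u_def inverse_eq_divide)
qed

section \<open>Superintegrability\<close>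

lemma sgn_constant:
  fixes f :: "'a::topological_space \<Rightarrow> real"
  assumes "connected U" and "U \<noteq> {}" and "continuous_on U f" and nz: "\<And>z. z \<in> U \<Longrightarrow> f z \<noteq> 0"
  obtains s where "s \<noteq> 0" and "\<And>z. z \<in> U \<Longrightarrow> sgn (f z) = s"
proof -
  have conn: "connected (f ` U)"
    using assms by (intro connected_continuous_image)
  have "sgn (f a) = sgn (f b)" if "a \<in> U" "b \<in> U" for a b
  proof (rule ccontr)
    assume "sgn (f a) \<noteq> sgn (f b)"
    then have "f a < 0 \<and> 0 < f b \<or> f b < 0 \<and> 0 < f a"
      using nz[OF that(1)] nz[OF that(2)] by (auto simp: sgn_if split: if_splits)
    then have "0 \<in> f ` U"
      using connectedD_interval[OF conn] that by (metis imageI less_imp_le)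
    then show False
      using nz by auto
  qed
  moreover obtain a where "a \<in> U"
    using \<open>U \<noteq> {}\<close> by blast
  ultimately show ?thesis
    using that[of "sgn (f a)"] nz by (metis sgn_zero_iff)
qed

lemma continuous_on_sol_det: "continuous_on U (sol_det n)"
  unfolding sol_det_def sol_xx_def sol_xy_def sol_yy_def conformal_factor_def
  by (intro continuous_intros)

lemma frechet_derivative_scaled:
  fixes F G :: "'a::real_normed_vector \<Rightarrow> real"
  assumes "open W" and "z \<in> W" and eq: "\<And>z. z \<in> W \<Longrightarrow> F z = c * G z"
    and "(G has_derivative G') (at z)"
  shows "frechet_derivative F (at z) = (\<lambda>v. c * G' v)"
proof (rule frechet_derivative_at[symmetric], rule has_derivative_transform_within_open[OF _ assms(1,2)])
  show "((\<lambda>z. c * G z) has_derivative (\<lambda>v. c * G' v)) (at z)"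
    using assms(4) by (rule has_derivative_mult_right)
qed (simp add: eq)

definition represents :: "(real^2 \<Rightarrow> real^2^2) \<Rightarrow> real^3 \<Rightarrow> real^2 \<Rightarrow> bool" where
  "represents h n z \<longleftrightarrow> det (h z) \<noteq> 0
     \<and> sigma_of h z = inverse (root 3 (conformal_factor z)) *\<^sub>R solution n z"

lemma represents_imp_nondegenerate:
  assumes "represents h n z"
  shows "sol_det n z \<noteq> 0"
proof -
  have "det (sigma_of h z) \<noteq> 0"
    using sgn_det_sigma_of[of h z] assms by (metis represents_def sgn_zero_iff)
  then show ?thesis
    using assms by (simp add: represents_def det_scaleR_2 det_solution)
qed

text \<open>The Hamiltonian and the associated integrals are homogeneous of degree three in the weighted
  tensors, so the cube root of \<open>w\<close> enters them only through its third power.\<close>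

lemma root_conformal_factor_cubed:
  "(inverse (root 3 (conformal_factor z)))^3 = 1 / conformal_factor z"
  by (simp add: power_divide odd_real_root_pow inverse_eq_divide)

lemma kinetic_hamiltonian_polar:
  assumes "represents g m z"
  shows "kinetic_hamiltonian g (z, p) = sgn (sol_det m z) / 2 * polar_integral m m (z, p)"
proof -
  define c where "c = inverse (root 3 (conformal_factor z))"
  have "kinetic_hamiltonian g (z, p)
      = \<bar>c^2 * sol_det m z\<bar> / 2 * (p \<bullet> ((c *\<^sub>R solution m z) *v p))"
    using kinetic_hamiltonian_sigma[of g z p] assms
    by (simp add: represents_def det_scaleR_2 det_solution flip: c_def)
  also have "\<bar>c^2 * sol_det m z\<bar> = c^2 * (sol_det m z * sgn (sol_det m z))"
    by (simp add: abs_mult flip: abs_sgn)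
  also have "\<dots> / 2 * (p \<bullet> ((c *\<^sub>R solution m z) *v p))
      = sgn (sol_det m z) / 2 * (c^3 * (sol_det m z * (p \<bullet> (solution m z *v p))))"
    by (simp add: scaleR_matrix_vector_assoc[symmetric] power2_eq_square power3_eq_cube)
  also have "\<dots> = sgn (sol_det m z) / 2 * polar_integral m m (z, p)"
    by (simp add: c_def root_conformal_factor_cubed flip: polar_integral_solution_self)
  finally show ?thesis .
qed

lemma associated_integral_polar:
  assumes g: "represents g m z" and h: "represents h n z" and w: "conformal_factor z \<noteq> 0"
  shows "associated_integral g h (z, p) = sgn (sol_det n z) * polar_integral m n (z, p)"
proof -
  define c where "c = inverse (root 3 (conformal_factor z))"
  have "c \<noteq> 0"
    using w by (simp add: c_def)
  then have "sgn (c^2 * sol_det n z) = sgn (sol_det n z)"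
    by (simp add: sgn_mult) (simp add: sgn_if)
  then have "associated_integral g h (z, p) = sgn (sol_det n z) * (p \<bullet>
      (((c *\<^sub>R solution m z) ** (c *\<^sub>R adj2 (solution n z)) ** (c *\<^sub>R solution m z)) *v p))"
    using associated_integral_sigma[of g z h p] g h
    by (simp add: represents_def adj2_scaleR det_scaleR_2 det_solution flip: c_def)
  also have "\<dots> = sgn (sol_det n z)
      * (c^3 * (p \<bullet> ((solution m z ** adj2 (solution n z) ** solution m z) *v p)))"
    unfolding sandwich_scaleR
    by (simp add: scaleR_matrix_vector_assoc[symmetric] power3_eq_cube)
  also have "\<dots> = sgn (sol_det n z) * polar_integral m n (z, p)"
    by (simp add: c_def root_conformal_factor_cubed flip: polar_integral_solution)
  finally show ?thesis .
qed

text \<open>Functional independence of nonzero multiples \<open>Fs ! i\<close> of three functions \<open>polar_integral m n\<close>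
  with linearly independent \<open>n\<close>: by linearity in \<open>n\<close> a relation between the differentials says that
  the differential of one such function vanishes.\<close>

lemma functionally_independent_polar:
  assumes "open U"
    and w: "\<And>z. z \<in> U \<Longrightarrow> conformal_factor z \<noteq> 0"
    and nondeg: "\<And>z. z \<in> U \<Longrightarrow> sol_det m z \<noteq> 0"
    and "length Fs = 3"
    and eq: "\<And>i a. i < 3 \<Longrightarrow> a \<in> U \<times> UNIV \<Longrightarrow> (Fs ! i) a = s i * polar_integral m (ns i) a"
    and s: "\<And>i. i < 3 \<Longrightarrow> s i \<noteq> 0"
    and basis: "\<And>a b c. a *\<^sub>R ns 0 + b *\<^sub>R ns 1 + c *\<^sub>R ns 2 = 0 \<Longrightarrow> a = 0 \<and> b = 0 \<and> c = 0"
  shows "functionally_independent (U \<times> UNIV) Fs"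
proof -
  let ?W = "U \<times> (UNIV :: (real^2) set)"
  have W: "open ?W"
    using \<open>open U\<close> by (simp add: open_Times)
  define D where "D = {a \<in> ?W. cubic_form m a \<noteq> 0}"
  have "continuous_on ?W (cubic_form m)"
    unfolding cubic_form_def case_prod_beta vel_x_def vel_y_def sol_xx_def sol_xy_def sol_yy_def
      conformal_factor_def by (intro continuous_intros)
  then have "open (?W \<inter> cubic_form m -` (- {0}))"
    using W by (intro continuous_open_preimage) auto
  also have "?W \<inter> cubic_form m -` (- {0}) = D"
    by (auto simp: D_def)
  finally have "open D" .
  moreover have "?W \<subseteq> closure D"
  proof
    fix a assume "a \<in> ?W"
    then obtain z p where a: "a = (z, p)" "z \<in> U"
      by (cases a) auto
    show "a \<in> closure D"
      unfolding closure_approachable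
    proof (intro allI impI)
      fix e :: real assume "e > 0"
      then obtain p' where "dist p' p < e" "cubic_form m (z, p') \<noteq> 0"
        by (rule dense_cubic_nonzero[OF w[OF a(2)] nondeg[OF a(2)]])
      then show "\<exists>b\<in>D. dist b a < e"
        using a by (intro bexI[of _ "(z, p')"]) (auto simp: D_def dist_Pair_Pair)
    qed
  qed
  moreover have "\<forall>i<length Fs. c i = 0"
    if a: "a \<in> D" and zero: "\<forall>v. (\<Sum>i<length Fs. c i * frechet_derivative (Fs ! i) (at a) v) = 0"
    for a and c :: "nat \<Rightarrow> real"
  proof -
    obtain z p where zp: "a = (z, p)" "z \<in> U" and cub: "cubic_form m (z, p) \<noteq> 0"
      using a by (cases a) (auto simp: D_def)
    have aW: "a \<in> ?W"
      using zp by simp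
    let ?d = "\<lambda>n. frechet_derivative (polar_integral m n) (at a)"
    have d: "(polar_integral m n has_derivative ?d n) (at a)" for n
      using polar_integral_has_frechet_derivative[OF w[OF zp(2)]] zp(1) by simp
    have Fs: "frechet_derivative (Fs ! i) (at a) v = s i * ?d (ns i) v" if "i < 3" for i v
      using fun_cong[OF frechet_derivative_scaled[OF W aW eq[OF that] d], of v] by simp
    define n where "n = (c 0 * s 0) *\<^sub>R ns 0 + (c 1 * s 1) *\<^sub>R ns 1 + (c 2 * s 2) *\<^sub>R ns 2"
    have lin: "polar_integral m n = (\<lambda>b. c 0 * s 0 * polar_integral m (ns 0) b
        + c 1 * s 1 * polar_integral m (ns 1) b + c 2 * s 2 * polar_integral m (ns 2) b)"
      using polar_integral_add_scaleR[of m 1 _ "c 2 * s 2" "ns 2"]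
        polar_integral_add_scaleR[of m "c 0 * s 0" "ns 0" "c 1 * s 1" "ns 1"]
      by (simp add: n_def fun_eq_iff)
    have "(polar_integral m n has_derivative (\<lambda>v. c 0 * s 0 * ?d (ns 0) v
        + c 1 * s 1 * ?d (ns 1) v + c 2 * s 2 * ?d (ns 2) v)) (at a)"
      unfolding lin by (intro has_derivative_add has_derivative_mult_right d)
    note total = fun_cong[OF frechet_derivative_at[OF this], symmetric]
    have dn: "?d n v = 0" for v
    proof -
      have "(\<Sum>i<3. c i * frechet_derivative (Fs ! i) (at a) v) = (\<Sum>i<3. c i * (s i * ?d (ns i) v))"
        by (intro sum.cong) (auto simp: Fs)
      also have "\<dots> = ?d n v"
        unfolding total[of v] by (simp add: numeral_3_eq_3 numeral_2_eq_2)
      finally show ?thesis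
        using zero[rule_format, of v] unfolding \<open>length Fs = 3\<close> by (rule trans[OF sym])
    qed
    have "n = 0"
    proof (rule polar_integral_nondegenerate[OF w nondeg cub])
      show "dx_polar m n z p = 0" "dp_polar m n z p = 0" "dq_polar m n z p = 0"
        using dn[of "(axis 1 1, 0)"] dn[of "(0, axis 1 1)"] dn[of "(0, axis 2 1)"] zp
        by (simp_all add: frechet_polar_integral[OF w] axis_def)
    qed (use zp in auto)
    then have "c 0 * s 0 = 0 \<and> c 1 * s 1 = 0 \<and> c 2 * s 2 = 0"
      unfolding n_def by (rule basis)
    then have "c 0 = 0 \<and> c 1 = 0 \<and> c 2 = 0"
      using s by simp
    then show ?thesis
      by (simp add: \<open>length Fs = 3\<close> numeral_3_eq_3 numeral_2_eq_2 less_Suc_eq)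
  qed
  moreover have "D \<subseteq> ?W"
    by (auto simp: D_def)
  ultimately show ?thesis
    unfolding functionally_independent_def by blast
qed

lemma superintegrable_of_independent_solutions:
  assumes "open U" and "connected U" and "U \<noteq> {}"
    and w: "\<And>z. z \<in> U \<Longrightarrow> conformal_factor z \<noteq> 0"
    and g: "\<And>z. z \<in> U \<Longrightarrow> represents g m z"
    and gbar: "\<And>z. z \<in> U \<Longrightarrow> represents gbar mbar z"
    and ghat: "\<And>z. z \<in> U \<Longrightarrow> represents ghat mhat z"
    and basis: "\<And>a b c. a *\<^sub>R m + b *\<^sub>R mbar + c *\<^sub>R mhat = 0 \<Longrightarrow> a = 0 \<and> b = 0 \<and> c = 0"
  shows "free_second_order_superintegrable U g
    [kinetic_hamiltonian g, associated_integral g gbar, associated_integral g ghat]"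
proof -
  let ?W = "U \<times> (UNIV :: (real^2) set)"
  let ?Fs = "[kinetic_hamiltonian g, associated_integral g gbar, associated_integral g ghat]"
  have W: "open ?W"
    using \<open>open U\<close> by (simp add: open_Times)
  have sign: "\<exists>s. s \<noteq> 0 \<and> (\<forall>z\<in>U. sgn (sol_det n z) = s)"
    if "\<And>z. z \<in> U \<Longrightarrow> represents h n z" for h n
    using sgn_constant[OF assms(2,3) continuous_on_sol_det[of U n]]
      represents_imp_nondegenerate that by metis
  obtain s where s: "s \<noteq> 0" "\<And>z. z \<in> U \<Longrightarrow> sgn (sol_det m z) = s"
    using sign[OF g] by blast
  obtain sbar where sbar: "sbar \<noteq> 0" "\<And>z. z \<in> U \<Longrightarrow> sgn (sol_det mbar z) = sbar"
    using sign[OF gbar] by blast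
  obtain shat where shat: "shat \<noteq> 0" "\<And>z. z \<in> U \<Longrightarrow> sgn (sol_det mhat z) = shat"
    using sign[OF ghat] by blast
  define co where "co = (\<lambda>i. [s / 2, sbar, shat] ! i)"
  define ns where "ns = (\<lambda>i. [m, mbar, mhat] ! i)"
  have eq: "(?Fs ! i) a = co i * polar_integral m (ns i) a" if "i < 3" "a \<in> ?W" for i a
    using that kinetic_hamiltonian_polar[OF g] associated_integral_polar[OF g gbar w]
      associated_integral_polar[OF g ghat w] s(2) sbar(2) shat(2)
    by (auto simp: co_def ns_def less_Suc_eq numeral_3_eq_3)
  have deriv: "frechet_derivative (?Fs ! i) (at a)
      = (\<lambda>v. co i * frechet_derivative (polar_integral m (ns i)) (at a) v)"
    if i: "i < 3" and a: "a \<in> ?W" for i a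
  proof (rule frechet_derivative_scaled[OF W a eq[OF i]])
    show "(polar_integral m (ns i) has_derivative frechet_derivative (polar_integral m (ns i)) (at a)) (at a)"
      using a polar_integral_has_frechet_derivative[OF w, of "fst a" m "ns i" "snd a"]
      by (simp add: mem_Times_iff)
  qed
  have "integral_of_motion U (kinetic_hamiltonian g) (?Fs ! i)" if i: "i < 3" for i
    unfolding integral_of_motion_def
  proof
    have "Ck_on k (\<lambda>a. co i * polar_integral m (ns i) a) ?W" for k
      using smooth_on_polar_integral[OF \<open>open U\<close> w, of m "ns i"]
      by (intro Ck_on_mult[OF W] Ck_on_const) (auto simp: smooth_on_def)
    from Ck_on_cong[OF W _ this] show "smooth_on (?Fs ! i) ?W"
      unfolding smooth_on_def using eq[OF i] by metis
    show "\<forall>a\<in>?W. poisson (?Fs ! i) (kinetic_hamiltonian g) a = 0"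
    proof
      fix a assume a: "a \<in> ?W"
      have "frechet_derivative (kinetic_hamiltonian g) (at a)
          = (\<lambda>v. s / 2 * frechet_derivative (polar_integral m m) (at a) v)"
        using deriv[of 0 a] a by (simp add: co_def ns_def)
      then have "poisson (?Fs ! i) (kinetic_hamiltonian g) a
          = co i * (s / 2) * poisson (polar_integral m (ns i)) (polar_integral m m) a"
        unfolding poisson_def deriv[OF i a] by (simp add: UNIV_2 algebra_simps)
      then show "poisson (?Fs ! i) (kinetic_hamiltonian g) a = 0"
        using poisson_polar_integral[OF w, of "fst a" m "ns i" "snd a"] a
        by (auto simp: mem_Times_iff)
    qed
  qed
  from this[of 0] this[of 1] this[of 2]
  have "integral_of_motion U (kinetic_hamiltonian g) F" if "F \<in> set ?Fs" for F
    using that by (auto simp: numeral_2_eq_2)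
  moreover have "quadratic_in_momenta U F" if "F \<in> set ?Fs" for F
  proof -
    have quad: "quadratic_in_momenta U G" if "\<And>z p. G (z, p) = p \<bullet> (A z *v p)" for G A
      unfolding quadratic_in_momenta_def using that
      by (intro exI[of _ A] exI[of _ "\<lambda>_. 0"]) simp
    have "quadratic_in_momenta U (kinetic_hamiltonian g)"
      by (rule quad[of _ "\<lambda>z. (1/2) *\<^sub>R matrix_inv (g z)"])
        (simp add: kinetic_hamiltonian_def scaleR_matrix_vector_assoc[symmetric])
    moreover have "quadratic_in_momenta U (associated_integral g h)" for h
      by (rule quad[of _ "\<lambda>z. matrix_inv (g z) ** killing_tensor_of g h z ** matrix_inv (g z)"])
        (simp add: associated_integral_def)
    ultimately show ?thesis
      using that by auto
  qed
  moreover have "functionally_independent ?W ?Fs"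
  proof (rule functionally_independent_polar[OF \<open>open U\<close> w _ _ eq])
    show "sol_det m z \<noteq> 0" if "z \<in> U" for z
      using represents_imp_nondegenerate g that by blast
    show "co i \<noteq> 0" if "i < 3" for i
      using that s sbar shat by (auto simp: co_def less_Suc_eq numeral_3_eq_3)
    show "a = 0 \<and> b = 0 \<and> c = 0" if "a *\<^sub>R ns 0 + b *\<^sub>R ns 1 + c *\<^sub>R ns 2 = 0" for a b c
      using basis[of a b c] that by (simp add: ns_def numeral_2_eq_2)
  qed auto
  ultimately show ?thesis
    unfolding free_second_order_superintegrable_def maximally_superintegrable_def by simp
qed

theorem theorem3:
  fixes U :: "(real^2) set"
    and g gbar ghat :: "real^2 \<Rightarrow> real^2^2"
    and X :: "real^2 \<Rightarrow> real^2"
    and \<theta> \<phi> :: real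
  assumes "open U" and "connected U" and "U \<noteq> {}" and "U \<subseteq> regular_points"
    and "0 < \<theta>" and "\<theta> < pi" and "0 \<le> \<phi>" and "\<phi> < 2 * pi"
    and "\<theta> = pi / 2 \<longrightarrow> \<phi> \<notin> {0, pi / 2, pi, 3 * pi / 2}"
    and "metric_on U g" and "metric_on U gbar" and "metric_on U ghat"
    and "\<forall>x\<in>U. sigma_of g x =
           (sin \<theta> * cos \<phi>) *\<^sub>R sigma_of g1 x + (sin \<theta> * sin \<phi>) *\<^sub>R sigma_of g2 x
           + cos \<theta> *\<^sub>R sigma_of g3 x"
    and "\<forall>x\<in>U. sigma_of gbar x =
           (cos \<theta> * cos \<phi>) *\<^sub>R sigma_of g1 x + (cos \<theta> * sin \<phi>) *\<^sub>R sigma_of g2 x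
           - sin \<theta> *\<^sub>R sigma_of g3 x"
    and "\<forall>x\<in>U. sigma_of ghat x = (- sin \<phi>) *\<^sub>R sigma_of g1 x + cos \<phi> *\<^sub>R sigma_of g2 x"
    and "degree_of_mobility U g = 3"
    and "projective_vector_field U g X" and "\<exists>x\<in>U. X x \<noteq> 0"
    and "\<forall>Y. projective_vector_field U g Y \<longrightarrow> (\<exists>c. \<forall>x\<in>U. Y x = c *\<^sub>R X x)"
    and "essential U g X"
  shows "free_second_order_superintegrable U g
           [kinetic_hamiltonian g, associated_integral g gbar, associated_integral g ghat]"
proof -
  have reg: "z \<in> regular_points" if "z \<in> U" for z
    using that \<open>U \<subseteq> regular_points\<close> by blast
  have "continuous_on U (\<lambda>z :: real^2. 3 * z$1 - (z$2)^2)"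
    by (intro continuous_intros)
  then obtain s where s: "s \<noteq> 0" "\<And>z. z \<in> U \<Longrightarrow> sgn (3 * z$1 - (z$2)^2) = s"
    using sgn_constant[OF \<open>connected U\<close> \<open>U \<noteq> {}\<close>] reg unfolding regular_points_def by blast
  \<comment> \<open>The constants by which the parametrisation of the solutions differs from the coefficients with
    respect to \<open>\<sigma>\<^sub>1\<close>, \<open>\<sigma>\<^sub>2\<close>, \<open>\<sigma>\<^sub>3\<close>.\<close>
  define \<alpha> \<kappa> where "\<alpha> = 2 / root 3 4" and "\<kappa> = s * root 3 4 / 4"
  have nz: "\<alpha> \<noteq> 0" "\<kappa> \<noteq> 0"
    using s(1) by (simp_all add: \<alpha>_def \<kappa>_def)
  define N :: "real \<Rightarrow> real \<Rightarrow> real \<Rightarrow> real^3" where "N = (\<lambda>a b c. vector [a * \<alpha>, b, c * \<kappa>])"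
  have N_expand: "N a b c = a *\<^sub>R vector [\<alpha>, 0, 0] + 1 *\<^sub>R (b *\<^sub>R vector [0, 1, 0] + c *\<^sub>R vector [0, 0, \<kappa>])"
    for a b c
    by (simp add: N_def vec_eq_iff forall_3 vector_3)
  have sigma: "a *\<^sub>R sigma_of g1 z + b *\<^sub>R sigma_of g2 z + c *\<^sub>R sigma_of g3 z
      = inverse (root 3 (conformal_factor z)) *\<^sub>R solution (N a b c) z" if "z \<in> U" for a b c z
    unfolding N_expand solution_add_scaleR
    using sigma_of_g1[OF reg[OF that]] sigma_of_g2[OF reg[OF that]]
      sigma_of_g3[OF reg[OF that], unfolded s(2)[OF that]]
    by (simp add: scaleR_add_right ac_simps flip: \<alpha>_def \<kappa>_def)
  have det: "det (h z) \<noteq> 0" if "metric_on U h" "z \<in> U" for h :: "real^2 \<Rightarrow> real^2^2" and z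
    using that by (simp add: metric_on_def)
  show ?thesis
  proof (rule superintegrable_of_independent_solutions[OF assms(1-3)])
    show "conformal_factor z \<noteq> 0" if "z \<in> U" for z
      using reg[OF that] by (simp add: regular_points_def conformal_factor_def)
    show "represents g (N (sin \<theta> * cos \<phi>) (sin \<theta> * sin \<phi>) (cos \<theta>)) z" if "z \<in> U" for z
      using that det assms(10,13) by (simp add: represents_def flip: sigma)
    show "represents gbar (N (cos \<theta> * cos \<phi>) (cos \<theta> * sin \<phi>) (- sin \<theta>)) z" if "z \<in> U" for z
      using that det assms(11,14) by (simp add: represents_def flip: sigma)
    show "represents ghat (N (- sin \<phi>) (cos \<phi>) 0) z" if "z \<in> U" for z
      using that det assms(12,15) by (simp add: represents_def flip: sigma)
    fix a b c
    assume "a *\<^sub>R N (sin \<theta> * cos \<phi>) (sin \<theta> * sin \<phi>) (cos \<theta>)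
      + b *\<^sub>R N (cos \<theta> * cos \<phi>) (cos \<theta> * sin \<phi>) (- sin \<theta>) + c *\<^sub>R N (- sin \<phi>) (cos \<phi>) 0 = 0"
    then have "\<alpha> * (a * (sin \<theta> * cos \<phi>) + b * (cos \<theta> * cos \<phi>) - c * sin \<phi>) = 0"
      and 2: "a * (sin \<theta> * sin \<phi>) + b * (cos \<theta> * sin \<phi>) + c * cos \<phi> = 0"
      and "\<kappa> * (a * cos \<theta> - b * sin \<theta>) = 0"
      by (simp_all add: N_def vec_eq_iff forall_3 vector_3 algebra_simps)
    then have 1: "a * (sin \<theta> * cos \<phi>) + b * (cos \<theta> * cos \<phi>) - c * sin \<phi> = 0"
      and 3: "a * cos \<theta> - b * sin \<theta> = 0"
      using nz by (simp_all only: mult_eq_0_iff) auto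
    \<comment> \<open>The three coefficient vectors are orthonormal.\<close>
    show "a = 0 \<and> b = 0 \<and> c = 0"
      using 1 2 3 sin_cos_squared_add[of \<theta>] sin_cos_squared_add[of \<phi>] by algebra
  qed
qed

end
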